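(* Let $T_1,T_2$ be two finite rooted ordered labeled trees, and work in the unit-cost edit model. Let $TT$ be one of the four traversal orders preorder, postorder, reverse preorder, reverse postorder, and let $S_r = TT(T_r)$ for $r\in\{1,2\}$ be the corresponding linearized node sequences. Then for every $\tau\in\mathbb{N}_0$, \[ \delta(T_1,T_2)\le\tau \quad\Longrightarrow\quad \mathrm{SED}(S_1,S_2)\;\le\;\text{SED-struct}(S_1,S_2,\tau)\;\le\;\delta(T_1,T_2)\;\le\;\tau . \] In particular, \[ \text{SED-struct}(S_1,S_2,\tau)>\tau \quad\Longrightarrow\quad \delta(T_1,T_2)>\tau . \]
   Context: Trees. A tree $T$ is a finite rooted ordered tree with node set $N(T)$; each node $u$ has a label $lbl(u)$. For a node $u$, the remaining nodes of $T$ are partitioned into four disjoint sets (the relationship axes): ancestors of $u$; descendants of $u$; preceding nodes (nodes before $u$ in preorder that are not ancestors of $u$, i.e. nodes to the left of $u$); following nodes (nodes after $u$ in preorder that are not descendants of $u$, i.e. nodes to the right of $u$). Their cardinalities are denoted $a(u)$, $d(u)$, $p(u)$, $f(u)$ respectively. Tree edit distance. An edit mapping between $T_1$ and $T_2$ is a set $M\subseteq N(T_1)\times N(T_2)$ such that for all $(v,w),(v',w')\in M$: $v=v'$ iff $w=w'$; $v$ is an ancestor of $v'$ iff $w$ is an ancestor of $w'$; $v$ is to the left of $v'$ iff $w$ is to the left of $w'$. With $M_1=\{v\mid (v,w)\in M\}$ and $M_2=\{w\mid (v,w)\in M\}$, its unit cost is \[ \operatorname{cost}(M)=|N(T_1)\setminus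 M_1|+|N(T_2)\setminus M_2|+\sum_{(v,w)\in M}\mathbf{1}_{lbl(v)\ne lbl(w)} . \] The tree edit distance (the minimum number of node insertions, deletions and relabelings transforming $T_1$ into $T_2$) is $\delta(T_1,T_2)=\min_M\operatorname{cost}(M)$, the minimum over all edit mappings between $T_1$ and $T_2$. Traversals. $TT(T)$ is the sequence of all nodes of $T$ (with their labels) in the order $TT$. Preorder lists a node before its descendants and visits siblings left to right; postorder lists a node after its descendants and visits siblings left to right; reverse preorder lists a node before its descendants and visits siblings right to left; reverse postorder lists a node after its descendants and visits siblings right to left. The traversal-specific axis set $X_{TT}$ (the two axes whose nodes occur after a node in $TT$) is $\{d,f\}$ for preorder, $\{a,f\}$ for postorder, $\{d,p\}$ for reverse preorder, $\{a,p\}$ for reverse postorder. Axes-aware structural difference. For $X\subseteq\{a,d,f,p\}$, $v\in N(T_1)$, $w\in N(T_2)$, \[ \Delta_{struct}^{X}(v,w)=\sum_{z\in X}|z(v)-z(w)| . \] String edit distance. Let $S_1=(x_1,\dots,x_m)$ and $S_2=(y_1,\dots,y_n)$ be node sequences. $\mathrm{SED}(S_1,S_2)=D[m,n]$ is the ordinary unit-cost string edit distance of the label sequences, where $D[i,0]=i$, $D[0,j]=j$, and for $i,j\ge1$, $D[i,j]=\min\{D[i-1,j]+1,\;D[i,j-1]+1,\;D[i-1,j-1]+\mathbf{1}_{lbl(x_i)\ne lbl(y_j)}\}$. SED-struct score. For a threshold $\tau$, let $D_\tau[i,0]=i$, $D_\tau[0,j]=j$, and for $i,j\ge1$ \[ D_\tau[i,j]=\min\{D_\tau[i-1,j]+1,\;D_\tau[i,j-1]+1,\;D_\tau[i-1,j-1]+c_{i,j}\},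 \] where $c_{i,j}=\infty$ if $\Delta_{struct}^{X_{TT}}(x_i,y_j)+D_\tau[i-1,j-1]>\tau$; otherwise $c_{i,j}=0$ if $lbl(x_i)=lbl(y_j)$, and $c_{i,j}=1$ if $lbl(x_i)\neq lbl(y_j)$. Then $\text{SED-struct}(S_1,S_2,\tau)=D_\tau[m,n]$ with $m=|S_1|$, $n=|S_2|$. *)

theory Defs
  imports Main "HOL-Library.Sublist" "HOL-Library.Extended_Nat"
begin

section \<open>Finite rooted ordered labeled trees\<close>

datatype 'a tree = Node 'a "'a tree list"

text \<open>A node is represented by its position, that is, the sequence of child indices on the path
  from the root to it. Its ancestors are then exactly its strict prefixes.\<close>

type_synonym pos = "nat list"

lemma size_child [termination_simp]: "i < length ts \<Longrightarrow> size (ts ! i) < Suc (size_list size ts)"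
  by (metis less_Suc_eq_le nth_mem order_refl size_list_estimation')

fun nodes :: "'a tree \<Rightarrow> pos set" where
  "nodes (Node l ts) = insert [] (\<Union>i\<in>{..<length ts}. (#) i ` nodes (ts ! i))"

text \<open>Only meaningful for positions in \<^const>\<open>nodes\<close>.\<close>

fun lbl :: "'a tree \<Rightarrow> pos \<Rightarrow> 'a" where
  "lbl (Node l ts) [] = l"
| "lbl (Node l ts) (i # p) = lbl (ts ! i) p"

abbreviation ancestor :: "pos \<Rightarrow> pos \<Rightarrow> bool" where
  "ancestor u v \<equiv> strict_prefix u v"


section \<open>Traversals\<close>

datatype traversal_order = Preorder | Postorder | Rev_Preorder | Rev_Postorder

text \<open>Turns the node sequences of the child subtrees (left to right) into sequences of positions
  of the parent tree.\<close>

definition shift_children :: "pos list list \<Rightarrow> pos list list" where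
  "shift_children pss = map2 (\<lambda>i. map ((#) i)) [0..<length pss] pss"

primrec preorder :: "'a tree \<Rightarrow> pos list" where
  "preorder (Node l ts) = [] # concat (shift_children (map preorder ts))"

primrec postorder :: "'a tree \<Rightarrow> pos list" where
  "postorder (Node l ts) = concat (shift_children (map postorder ts)) @ [[]]"

primrec rev_preorder :: "'a tree \<Rightarrow> pos list" where
  "rev_preorder (Node l ts) = [] # concat (rev (shift_children (map rev_preorder ts)))"

primrec rev_postorder :: "'a tree \<Rightarrow> pos list" where
  "rev_postorder (Node l ts) = concat (rev (shift_children (map rev_postorder ts))) @ [[]]"

fun traversal :: "traversal_order \<Rightarrow> 'a tree \<Rightarrow> pos list" where
  "traversal Preorder = preorder"
| "traversal Postorder = postorder"
| "traversal Rev_Preorder = rev_preorder"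
| "traversal Rev_Postorder = rev_postorder"


section \<open>Relationship axes\<close>

definition occurs_before :: "'b list \<Rightarrow> 'b \<Rightarrow> 'b \<Rightarrow> bool" where
  "occurs_before xs u v \<longleftrightarrow> (\<exists>i j. i < j \<and> j < length xs \<and> xs ! i = u \<and> xs ! j = v)"

definition left_of :: "'a tree \<Rightarrow> pos \<Rightarrow> pos \<Rightarrow> bool" where
  "left_of T u v \<longleftrightarrow> occurs_before (preorder T) u v \<and> \<not> ancestor u v"

definition right_of :: "'a tree \<Rightarrow> pos \<Rightarrow> pos \<Rightarrow> bool" where
  "right_of T u v \<longleftrightarrow> occurs_before (preorder T) v u \<and> \<not> ancestor v u"

datatype axis = Anc | Desc | Foll | Prec

fun axis_nodes :: "'a tree \<Rightarrow> axis \<Rightarrow> pos \<Rightarrow> pos set" where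
  "axis_nodes T Anc u = {v \<in> nodes T. ancestor v u}"
| "axis_nodes T Desc u = {v \<in> nodes T. ancestor u v}"
| "axis_nodes T Foll u = {v \<in> nodes T. right_of T v u}"
| "axis_nodes T Prec u = {v \<in> nodes T. left_of T v u}"

definition axis_card :: "'a tree \<Rightarrow> axis \<Rightarrow> pos \<Rightarrow> nat" where
  "axis_card T z u = card (axis_nodes T z u)"

fun axis_set :: "traversal_order \<Rightarrow> axis set" where
  "axis_set Preorder = {Desc, Foll}"
| "axis_set Postorder = {Anc, Foll}"
| "axis_set Rev_Preorder = {Desc, Prec}"
| "axis_set Rev_Postorder = {Anc, Prec}"

definition struct_diff :: "axis set \<Rightarrow> 'a tree \<Rightarrow> 'a tree \<Rightarrow> pos \<Rightarrow> pos \<Rightarrow> nat" where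
  "struct_diff X T1 T2 v w =
    (\<Sum>z\<in>X. nat \<bar>int (axis_card T1 z v) - int (axis_card T2 z w)\<bar>)"


section \<open>Tree edit distance\<close>

definition edit_mapping :: "'a tree \<Rightarrow> 'a tree \<Rightarrow> (pos \<times> pos) set \<Rightarrow> bool" where
  "edit_mapping T1 T2 M \<longleftrightarrow> M \<subseteq> nodes T1 \<times> nodes T2 \<and>
    (\<forall>(v, w)\<in>M. \<forall>(v', w')\<in>M.
      (v = v' \<longleftrightarrow> w = w') \<and>
      (ancestor v v' \<longleftrightarrow> ancestor w w') \<and>
      (left_of T1 v v' \<longleftrightarrow> left_of T2 w w'))"

definition mapping_cost :: "'a tree \<Rightarrow> 'a tree \<Rightarrow> (pos \<times> pos) set \<Rightarrow> nat" where
  "mapping_cost T1 T2 M = card (nodes T1 - fst ` M) + card (nodes T2 - snd ` M) +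
    (\<Sum>(v, w)\<in>M. of_bool (lbl T1 v \<noteq> lbl T2 w))"

definition tree_edit_distance :: "'a tree \<Rightarrow> 'a tree \<Rightarrow> nat" where
  "tree_edit_distance T1 T2 = Min (mapping_cost T1 T2 ` {M. edit_mapping T1 T2 M})"

text \<open>The minimum is taken over a finite nonempty set.\<close>

lemma finite_nodes: "finite (nodes T)"
  by (induction T rule: nodes.induct) simp

lemma finite_edit_mappings: "finite {M. edit_mapping T1 T2 M}"
  by (rule finite_subset[of _ "Pow (nodes T1 \<times> nodes T2)"])
    (auto simp: edit_mapping_def finite_nodes)

lemma edit_mapping_empty: "edit_mapping T1 T2 {}"
  by (simp add: edit_mapping_def)


section \<open>String edit distance and the SED-struct score\<close>

text \<open>The sequences are indexed from 0, so the \<open>i\<close>-th entry in the usual counting is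
  \<open>S ! (i - 1)\<close>. The trees are needed to look up labels and axis cardinalities.\<close>

fun sed_table :: "'a tree \<Rightarrow> 'a tree \<Rightarrow> pos list \<Rightarrow> pos list \<Rightarrow> nat \<Rightarrow> nat \<Rightarrow> nat" where
  "sed_table T1 T2 S1 S2 i 0 = i"
| "sed_table T1 T2 S1 S2 0 (Suc j) = Suc j"
| "sed_table T1 T2 S1 S2 (Suc i) (Suc j) =
    Min {sed_table T1 T2 S1 S2 i (Suc j) + 1,
         sed_table T1 T2 S1 S2 (Suc i) j + 1,
         sed_table T1 T2 S1 S2 i j + of_bool (lbl T1 (S1 ! i) \<noteq> lbl T2 (S2 ! j))}"

definition sed :: "'a tree \<Rightarrow> 'a tree \<Rightarrow> pos list \<Rightarrow> pos list \<Rightarrow> nat" where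
  "sed T1 T2 S1 S2 = sed_table T1 T2 S1 S2 (length S1) (length S2)"

fun sed_struct_table ::
  "axis set \<Rightarrow> 'a tree \<Rightarrow> 'a tree \<Rightarrow> pos list \<Rightarrow> pos list \<Rightarrow> nat \<Rightarrow> nat \<Rightarrow> nat \<Rightarrow> enat" where
  "sed_struct_table X T1 T2 S1 S2 \<tau> i 0 = enat i"
| "sed_struct_table X T1 T2 S1 S2 \<tau> 0 (Suc j) = enat (Suc j)"
| "sed_struct_table X T1 T2 S1 S2 \<tau> (Suc i) (Suc j) =
    Min {sed_struct_table X T1 T2 S1 S2 \<tau> i (Suc j) + 1,
         sed_struct_table X T1 T2 S1 S2 \<tau> (Suc i) j + 1,
         sed_struct_table X T1 T2 S1 S2 \<tau> i j +
           (if enat (struct_diff X T1 T2 (S1 ! i) (S2 ! j)) + sed_struct_table X T1 T2 S1 S2 \<tau> i j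
                > enat \<tau>
            then \<infinity>
            else if lbl T1 (S1 ! i) = lbl T2 (S2 ! j) then 0 else 1)}"

definition sed_struct ::
  "axis set \<Rightarrow> 'a tree \<Rightarrow> 'a tree \<Rightarrow> pos list \<Rightarrow> pos list \<Rightarrow> nat \<Rightarrow> enat" where
  "sed_struct X T1 T2 S1 S2 \<tau> = sed_struct_table X T1 T2 S1 S2 \<tau> (length S1) (length S2)"

end

theory Submission
  imports Defs
begin

text \<open>Fix an optimal edit mapping \<open>M\<close>. Since the traversal order is a union of two relationship axes,
  \<open>M\<close> is increasing with respect to it, and hence describes an alignment path through the
  \<open>SED-struct\<close> table. Along this path the table entries are bounded by the cost of \<open>M\<close> on the
  prefixes. At a pair \<open>(v, w) \<in> M\<close> on the path, \<open>M\<close> matches up the mapped nodes in each axis of \<open>v\<close>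
  and \<open>w\<close>, so the structural difference is at most the number of unmapped nodes after \<open>v\<close> and \<open>w\<close>.
  Together with the cost of the prefixes this is at most \<open>cost(M) \<le> \<tau>\<close>, so the path is
  never cut off by the threshold.\<close>


section \<open>Axes as relations on positions\<close>

text \<open>Tree-free form of \<open>left_of\<close>: two positions are compared at the first index
  where they diverge, so a position is unrelated to its prefixes. Agreement on nodes is
  \<open>left_of_iff\<close>.\<close>

fun left_pos :: "pos \<Rightarrow> pos \<Rightarrow> bool" where
  "left_pos (i # u) (j # v) \<longleftrightarrow> i < j \<or> i = j \<and> left_pos u v"
| "left_pos _ _ \<longleftrightarrow> False"

text \<open>Argument order: the second position lies in axis \<open>z\<close> of the first.\<close>

fun axis_rel :: "axis \<Rightarrow> pos \<Rightarrow> pos \<Rightarrow> bool" where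
  "axis_rel Anc u v \<longleftrightarrow> ancestor v u"
| "axis_rel Desc u v \<longleftrightarrow> ancestor u v"
| "axis_rel Foll u v \<longleftrightarrow> left_pos u v"
| "axis_rel Prec u v \<longleftrightarrow> left_pos v u"

definition before :: "traversal_order \<Rightarrow> pos \<Rightarrow> pos \<Rightarrow> bool" where
  "before TT u v \<longleftrightarrow> (\<exists>z\<in>axis_set TT. axis_rel z u v)"

lemma left_pos_asym: "left_pos u v \<Longrightarrow> \<not> left_pos v u"
  by (induction u v rule: left_pos.induct) auto

lemma left_pos_not_ancestor: "left_pos u v \<Longrightarrow> \<not> ancestor u v \<and> \<not> ancestor v u"
  by (induction u v rule: left_pos.induct) auto

lemma ancestor_asym: "ancestor u v \<Longrightarrow> \<not> ancestor v u"
  by (meson prefix_order.less_asym)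

lemma axis_rel_unique:
  assumes "axis_rel z u v" "axis_rel z' u v"
  shows "z = z'"
  using assms left_pos_asym[of u v] left_pos_not_ancestor[of u v] left_pos_not_ancestor[of v u]
    ancestor_asym[of u v]
  by (cases z; cases z') auto

text \<open>No \<open>axis_set\<close> contains an axis together with its converse, and distinct
  axes exclude each other.\<close>

lemma before_asym: "before TT u v \<Longrightarrow> \<not> before TT v u"
  using left_pos_asym[of u v] left_pos_not_ancestor[of u v] left_pos_not_ancestor[of v u]
    ancestor_asym[of u v]
  by (cases TT) (auto simp: before_def)

lemma before_irrefl: "\<not> before TT u u"
  using before_asym by blast

lemma before_Cons: "before TT (i # u) (i # v) \<longleftrightarrow> before TT u v"
  by (cases TT) (auto simp: before_def)


section \<open>Traversals are sorted\<close>

text \<open>Removing the last child leaves the indices of the other children unchanged; this is why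
  the inductions over child lists run from the right.\<close>

lemma shift_children_snoc:
  "shift_children (pss @ [ps]) = shift_children pss @ [map ((#) (length pss)) ps]"
  by (simp add: shift_children_def)

lemma set_concat_shift_children:
  "set (concat (shift_children pss)) = (\<Union>i<length pss. (#) i ` set (pss ! i))"
proof (induction pss rule: rev_induct)
  case Nil
  then show ?case by (simp add: shift_children_def)
next
  case (snoc ps pss)
  then show ?case
    by (simp add: shift_children_snoc lessThan_Suc nth_append Un_commute)
qed

lemma sorted_wrt_concat_shift_children:
  assumes "\<And>ps. ps \<in> set pss \<Longrightarrow> sorted_wrt R ps"
    and "\<And>i u v. R u v \<Longrightarrow> R (i # u) (i # v)"
    and "\<And>i j u v. i < j \<Longrightarrow> R (i # u) (j # v)"
  shows "sorted_wrt R (concat (shift_children pss))"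
  using assms(1)
proof (induction pss rule: rev_induct)
  case Nil
  then show ?case by (simp add: shift_children_def)
next
  case (snoc ps pss)
  have "sorted_wrt R (map ((#) (length pss)) ps)"
    using snoc.prems assms(2) by (simp add: sorted_wrt_iff_nth_less)
  with snoc show ?case
    using set_concat_shift_children[of pss] assms(3)
    by (auto simp: shift_children_snoc sorted_wrt_append simp del: set_concat)
qed

lemma sorted_wrt_concat_rev_shift_children:
  assumes "\<And>ps. ps \<in> set pss \<Longrightarrow> sorted_wrt R ps"
    and "\<And>i u v. R u v \<Longrightarrow> R (i # u) (i # v)"
    and "\<And>i j u v. j < i \<Longrightarrow> R (i # u) (j # v)"
  shows "sorted_wrt R (concat (rev (shift_children pss)))"
  using assms(1)
proof (induction pss rule: rev_induct)
  case Nil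
  then show ?case by (simp add: shift_children_def)
next
  case (snoc ps pss)
  have "sorted_wrt R (map ((#) (length pss)) ps)"
    using snoc.prems assms(2) by (simp add: sorted_wrt_iff_nth_less)
  moreover have "set (concat (rev (shift_children pss))) = set (concat (shift_children pss))"
    by simp
  ultimately show ?case
    using snoc set_concat_shift_children[of pss] assms(3)
    by (auto simp: shift_children_snoc sorted_wrt_append simp del: set_concat)
qed

lemma set_traversal: "set (traversal TT T) = nodes T"
proof (induction T)
  case (Node l ts)
  have *: "(\<Union>i<length ts. (#) i ` set (map (traversal TT) ts ! i)) =
    (\<Union>i<length ts. (#) i ` nodes (ts ! i))"
    using Node by auto
  show ?case
    using * set_concat_shift_children[of "map (traversal TT) ts"]
    by (cases TT) auto
qed

text \<open>Inside a child block the common head index cancels by \<open>before_Cons\<close>;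
  between blocks the horizontal axis of \<open>TT\<close> decides; the root is placed by the
  vertical one.\<close>

lemma sorted_traversal: "sorted_wrt (before TT) (traversal TT T)"
proof (induction T)
  case (Node l ts)
  have IH: "sorted_wrt (before TT) ps" if "ps \<in> set (map (traversal TT) ts)" for ps
    using that Node by auto
  have nonempty: "q \<noteq> []" if "q \<in> set (concat (shift_children (map (traversal TT) ts)))" for q
    using that unfolding set_concat_shift_children by auto
  have concat: "sorted_wrt (before TT) (concat (shift_children (map (traversal TT) ts)))"
    if "TT = Preorder \<or> TT = Postorder"
    using that
    by (intro sorted_wrt_concat_shift_children IH) (auto simp: before_Cons, auto simp: before_def)
  have concat_rev: "sorted_wrt (before TT) (concat (rev (shift_children (map (traversal TT) ts))))"
    if "TT = Rev_Preorder \<or> TT = Rev_Postorder"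
    using that
    by (intro sorted_wrt_concat_rev_shift_children IH)
      (auto simp: before_Cons, auto simp: before_def)
  have set_rev: "set (concat (rev pss)) = set (concat pss)" for pss :: "pos list list"
    by simp
  have root: "before Preorder [] q" "before Rev_Preorder [] q"
    "before Postorder q []" "before Rev_Postorder q []" if "q \<noteq> []" for q
    using that by (cases q; auto simp: before_def)+
  show ?case
    using concat concat_rev nonempty
    by (cases TT) (auto simp: sorted_wrt_append set_rev simp del: set_concat intro!: root)
qed

lemma distinct_traversal: "distinct (traversal TT T)"
  using sorted_traversal[of TT T]
  by (auto simp: distinct_conv_nth sorted_wrt_iff_nth_less before_irrefl)
    (metis before_irrefl linorder_neqE_nat)

text \<open>Occurring earlier in the sorted preorder list means being an ancestor or lying to the
  left, and \<open>left_of\<close> excludes the former. For the converse, two distinct nodes occur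
  in one order or the other, and asymmetry rules out the wrong one.\<close>

lemma left_of_iff:
  assumes "u \<in> nodes T" "v \<in> nodes T"
  shows "left_of T u v \<longleftrightarrow> left_pos u v"
proof -
  have sorted: "sorted_wrt (before Preorder) (preorder T)" and set: "set (preorder T) = nodes T"
    using sorted_traversal[of Preorder T] set_traversal[of Preorder T] by simp_all
  have before: "before Preorder x y" if "occurs_before (preorder T) x y" for x y
    using that sorted by (auto simp: occurs_before_def sorted_wrt_iff_nth_less)
  have total: "occurs_before (preorder T) u v \<or> occurs_before (preorder T) v u" if "u \<noteq> v"
    using assms that unfolding occurs_before_def set[symmetric] in_set_conv_nth
    by (metis linorder_neqE_nat)
  show ?thesis
  proof
    assume "left_of T u v"
    then show "left_pos u v"
      using before by (auto simp: left_of_def before_def)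
  next
    assume "left_pos u v"
    then have "before Preorder u v" "\<not> ancestor u v"
      using left_pos_not_ancestor by (auto simp: before_def)
    then show "left_of T u v"
      using total before[of v u] before_asym[of Preorder u v] before_irrefl[of Preorder v]
      by (auto simp: left_of_def)
  qed
qed

lemma right_of_iff_left_of: "right_of T u v \<longleftrightarrow> left_of T v u"
  by (simp add: right_of_def left_of_def)

lemma axis_nodes_eq:
  assumes "u \<in> nodes T"
  shows "axis_nodes T z u = {v \<in> nodes T. axis_rel z u v}"
  using assms by (cases z) (auto simp: right_of_iff_left_of left_of_iff)


section \<open>Edit mappings and structural differences\<close>

lemma finite_edit_mapping: "edit_mapping T1 T2 M \<Longrightarrow> finite M"
  by (auto simp: edit_mapping_def finite_nodes intro: finite_subset[of M "nodes T1 \<times> nodes T2"])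

lemma edit_mappingD:
  assumes M: "edit_mapping T1 T2 M" and vw: "(v, w) \<in> M" and vw': "(v', w') \<in> M"
  shows "v = v' \<longleftrightarrow> w = w'" "ancestor v v' \<longleftrightarrow> ancestor w w'" "left_of T1 v v' \<longleftrightarrow> left_of T2 w w'"
proof -
  have "\<forall>(v', w')\<in>M. (v = v' \<longleftrightarrow> w = w') \<and> (ancestor v v' \<longleftrightarrow> ancestor w w') \<and>
    (left_of T1 v v' \<longleftrightarrow> left_of T2 w w')"
    using bspec[OF conjunct2[OF M[unfolded edit_mapping_def]] vw] unfolding prod.case .
  from bspec[OF this vw'] show "v = v' \<longleftrightarrow> w = w'" "ancestor v v' \<longleftrightarrow> ancestor w w'"
    "left_of T1 v v' \<longleftrightarrow> left_of T2 w w'"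
    unfolding prod.case by blast+
qed

lemma edit_mapping_axis_rel:
  assumes "edit_mapping T1 T2 M" "(v, w) \<in> M" "(v', w') \<in> M"
  shows "axis_rel z v v' \<longleftrightarrow> axis_rel z w w'"
proof -
  have "v \<in> nodes T1" "v' \<in> nodes T1" "w \<in> nodes T2" "w' \<in> nodes T2"
    using assms by (auto simp: edit_mapping_def)
  then show ?thesis
    using edit_mappingD(2,3)[OF assms] edit_mappingD(2,3)[OF assms(1,3,2)]
    by (cases z) (auto simp: left_of_iff)
qed

lemma edit_mapping_before:
  assumes "edit_mapping T1 T2 M" "(v, w) \<in> M" "(v', w') \<in> M"
  shows "before TT v v' \<longleftrightarrow> before TT w w'"
  using edit_mapping_axis_rel[OF assms] by (simp add: before_def)

lemma edit_mapping_inj: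
  assumes "edit_mapping T1 T2 M"
  shows "inj_on fst M" "inj_on snd M"
  using edit_mappingD(1)[OF assms] by (auto simp: inj_on_def)

text \<open>The mapped nodes in axis \<open>z\<close> of \<open>v\<close> and of \<open>w\<close>
  correspond one to one under \<open>M\<close>, so they cancel in the difference.\<close>

lemma axis_card_diff_le:
  assumes M: "edit_mapping T1 T2 M" and vw: "(v, w) \<in> M"
  shows "nat \<bar>int (axis_card T1 z v) - int (axis_card T2 z w)\<bar> \<le>
    card {u \<in> nodes T1 - fst ` M. axis_rel z v u} + card {u \<in> nodes T2 - snd ` M. axis_rel z w u}"
proof -
  have sub: "M \<subseteq> nodes T1 \<times> nodes T2"
    using M by (simp add: edit_mapping_def)
  define P where "P = {(v', w') \<in> M. axis_rel z v v'}"
  have split1: "axis_nodes T1 z v = fst ` P \<union> {u \<in> nodes T1 - fst ` M. axis_rel z v u}"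
    using sub vw by (subst axis_nodes_eq) (force simp: P_def)+
  \<comment> \<open>Selecting pairs on either side gives the same \<open>P\<close>; hence its two
    projections, of equal size, are the mapped parts of both axes.\<close>
  have P_eq: "P = {(v', w') \<in> M. axis_rel z w w'}"
    using edit_mapping_axis_rel[OF M vw] by (auto simp: P_def)
  have split2: "axis_nodes T2 z w = snd ` P \<union> {u \<in> nodes T2 - snd ` M. axis_rel z w u}"
    using sub vw by (subst axis_nodes_eq) (force simp: P_eq)+
  have "P \<subseteq> M"
    by (auto simp: P_def)
  then have fin: "finite P" and "card (fst ` P) = card P" "card (snd ` P) = card P"
    using finite_edit_mapping[OF M] edit_mapping_inj[OF M]
    by (auto intro: finite_subset card_image inj_on_subset)
  moreover have "card (axis_nodes T1 z v) =
      card (fst ` P) + card {u \<in> nodes T1 - fst ` M. axis_rel z v u}"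
    unfolding split1 using fin \<open>P \<subseteq> M\<close> by (intro card_Un_disjoint) (auto simp: finite_nodes)
  moreover have "card (axis_nodes T2 z w) =
      card (snd ` P) + card {u \<in> nodes T2 - snd ` M. axis_rel z w u}"
    unfolding split2 using fin \<open>P \<subseteq> M\<close> by (intro card_Un_disjoint) (auto simp: finite_nodes)
  ultimately show ?thesis
    by (simp add: axis_card_def)
qed

lemma finite_axis_set: "finite (axis_set TT)"
  by (cases TT) auto

text \<open>The axes are disjoint by \<open>axis_rel_unique\<close>, so summing over them counts no
  node twice.\<close>

lemma sum_card_axis_rel:
  assumes "finite A"
  shows "(\<Sum>z\<in>axis_set TT. card {u \<in> A. axis_rel z v u}) = card {u \<in> A. before TT v u}"
proof -
  have "{u \<in> A. before TT v u} = (\<Union>z\<in>axis_set TT. {u \<in> A. axis_rel z v u})"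
    by (auto simp: before_def)
  also have "card \<dots> = (\<Sum>z\<in>axis_set TT. card {u \<in> A. axis_rel z v u})"
    using assms axis_rel_unique by (intro card_UN_disjoint) (auto simp: finite_axis_set)
  finally show ?thesis ..
qed

lemma struct_diff_le:
  assumes "edit_mapping T1 T2 M" "(v, w) \<in> M"
  shows "struct_diff (axis_set TT) T1 T2 v w \<le>
    card {u \<in> nodes T1 - fst ` M. before TT v u} + card {u \<in> nodes T2 - snd ` M. before TT w u}"
proof -
  have "struct_diff (axis_set TT) T1 T2 v w \<le>
    (\<Sum>z\<in>axis_set TT. card {u \<in> nodes T1 - fst ` M. axis_rel z v u} +
      card {u \<in> nodes T2 - snd ` M. axis_rel z w u})"
    unfolding struct_diff_def by (intro sum_mono axis_card_diff_le assms)
  also have "\<dots> =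
    card {u \<in> nodes T1 - fst ` M. before TT v u} + card {u \<in> nodes T2 - snd ` M. before TT w u}"
    by (simp only: sum.distrib sum_card_axis_rel finite_nodes finite_Diff)
  finally show ?thesis .
qed


section \<open>Bounding the table\<close>

lemma enat_add_le_add: "enat m \<le> x \<Longrightarrow> enat (m + n) \<le> x + enat n"
  by (metis add_right_mono plus_enat_simps(1))

lemma add_le_enat_add: "x \<le> enat m \<Longrightarrow> x + enat n \<le> enat (m + n)"
  by (metis add_right_mono plus_enat_simps(1))

text \<open>Both tables obey the same recurrence, except that the threshold may raise the diagonal
  charge to \<open>\<infinity>\<close>.\<close>

lemma sed_table_le_sed_struct_table:
  "enat (sed_table T1 T2 S1 S2 i j) \<le> sed_struct_table X T1 T2 S1 S2 \<tau> i j"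
proof (induction T1 T2 S1 S2 i j rule: sed_table.induct)
  case (3 T1 T2 S1 S2 i j)
  let ?s = "sed_table T1 T2 S1 S2" and ?D = "sed_struct_table X T1 T2 S1 S2 \<tau>"
  let ?b = "of_bool (lbl T1 (S1 ! i) \<noteq> lbl T2 (S2 ! j)) :: nat"
  let ?c = "if enat (struct_diff X T1 T2 (S1 ! i) (S2 ! j)) + ?D i j > enat \<tau> then \<infinity>
            else if lbl T1 (S1 ! i) = lbl T2 (S2 ! j) then 0 else 1 :: enat"
  have "enat (?s i (Suc j) + 1) \<le> ?D i (Suc j) + 1" "enat (?s (Suc i) j + 1) \<le> ?D (Suc i) j + 1"
    unfolding one_enat_def using 3 by (blast intro: enat_add_le_add)+
  moreover have "enat (?s i j + ?b) \<le> ?D i j + ?c"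
    using enat_add_le_add[OF 3(3), of ?b] by (auto simp: zero_enat_def one_enat_def)
  moreover have "?s (Suc i) (Suc j) \<le> ?s i (Suc j) + 1" "?s (Suc i) (Suc j) \<le> ?s (Suc i) j + 1"
    "?s (Suc i) (Suc j) \<le> ?s i j + ?b"
    by simp_all
  ultimately have "enat (?s (Suc i) (Suc j)) \<le> ?D i (Suc j) + 1"
    "enat (?s (Suc i) (Suc j)) \<le> ?D (Suc i) j + 1" "enat (?s (Suc i) (Suc j)) \<le> ?D i j + ?c"
    by (meson enat_ord_simps(1) order_trans)+
  then show ?case
    by (simp del: sed_table.simps)
qed simp_all

text \<open>The share of the mapping cost falling on two prefixes. Relabelings are selected by the
  first component only; on the alignment path the second component then lies in \<open>B\<close> as
  well.\<close>

definition prefix_cost ::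
  "'a tree \<Rightarrow> 'a tree \<Rightarrow> (pos \<times> pos) set \<Rightarrow> pos set \<Rightarrow> pos set \<Rightarrow> nat" where
  "prefix_cost T1 T2 M A B = card (A - fst ` M) + card (B - snd ` M) +
    (\<Sum>(v, w)\<in>{(v, w) \<in> M. v \<in> A}. of_bool (lbl T1 v \<noteq> lbl T2 w))"

text \<open>This and the next two lemmas match the three moves in the table: each extension costs
  exactly the charge of a deletion, an insertion or a permitted diagonal step.\<close>

lemma prefix_cost_insert_left:
  assumes "finite A" "v \<notin> A" "v \<notin> fst ` M"
  shows "prefix_cost T1 T2 M (insert v A) B = prefix_cost T1 T2 M A B + 1"
proof -
  have "{(v', w') \<in> M. v' \<in> insert v A} = {(v', w') \<in> M. v' \<in> A}"
    using assms(3) by force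
  moreover have "card (insert v A - fst ` M) = Suc (card (A - fst ` M))"
    using assms by (simp add: insert_Diff_if)
  ultimately show ?thesis
    by (simp add: prefix_cost_def)
qed

lemma prefix_cost_insert_right:
  assumes "finite B" "w \<notin> B" "w \<notin> snd ` M"
  shows "prefix_cost T1 T2 M A (insert w B) = prefix_cost T1 T2 M A B + 1"
  using assms by (simp add: prefix_cost_def insert_Diff_if)

lemma prefix_cost_insert_both:
  assumes M: "edit_mapping T1 T2 M" and vw: "(v, w) \<in> M" and "v \<notin> A"
  shows "prefix_cost T1 T2 M (insert v A) (insert w B) =
    prefix_cost T1 T2 M A B + of_bool (lbl T1 v \<noteq> lbl T2 w)"
proof -
  have eq: "{(v', w') \<in> M. v' \<in> insert v A} = insert (v, w) {(v', w') \<in> M. v' \<in> A}"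
    using edit_mappingD(1)[OF M vw] vw by auto
  have "finite {(v', w') \<in> M. v' \<in> A}"
    using finite_edit_mapping[OF M] by (rule rev_finite_subset) auto
  moreover have "v \<in> fst ` M" "w \<in> snd ` M"
    using vw by force+
  ultimately show ?thesis
    unfolding prefix_cost_def eq using \<open>v \<notin> A\<close> by (simp add: insert_Diff_if)
qed

section \<open>Upper bound: the alignment path stays within the threshold\<close>

lemma sorted_wrt_take_nth:
  "sorted_wrt R xs \<Longrightarrow> i < length xs \<Longrightarrow> x \<in> set (take i xs) \<Longrightarrow> R x (xs ! i)"
  by (auto simp: sorted_wrt_iff_nth_less in_set_conv_nth)

text \<open>The structural difference is paid for by unmapped nodes after \<open>v\<close> and
  \<open>w\<close>, the prefix cost by unmapped nodes before them and by relabelings: disjoint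
  shares of the total cost.\<close>

lemma struct_diff_prefix_cost_le:
  assumes M: "edit_mapping T1 T2 M" and vw: "(v, w) \<in> M"
    and A: "A \<subseteq> nodes T1" "\<And>u. u \<in> A \<Longrightarrow> before TT u v"
    and B: "B \<subseteq> nodes T2" "\<And>u. u \<in> B \<Longrightarrow> before TT u w"
  shows "struct_diff (axis_set TT) T1 T2 v w + prefix_cost T1 T2 M A B \<le> mapping_cost T1 T2 M"
proof -
  have disjoint_sum: "card {u \<in> N - F. before TT x u} + card (C - F) \<le> card (N - F)"
    if "finite N" "C \<subseteq> N" "\<And>u. u \<in> C \<Longrightarrow> before TT u x" for N F C x
  proof -
    have "card {u \<in> N - F. before TT x u} + card (C - F) =
      card ({u \<in> N - F. before TT x u} \<union> (C - F))"
      using that before_asym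
      by (intro card_Un_disjoint[symmetric]) (auto intro: finite_subset)
    also have "\<dots> \<le> card (N - F)"
      using that by (intro card_mono) auto
    finally show ?thesis .
  qed
  have "(\<Sum>(v, w)\<in>{(v, w) \<in> M. v \<in> A}. of_bool (lbl T1 v \<noteq> lbl T2 w)) \<le>
    (\<Sum>(v, w)\<in>M. of_bool (lbl T1 v \<noteq> lbl T2 w) :: nat)"
    using finite_edit_mapping[OF M] by (intro sum_mono2) auto
  with struct_diff_le[OF M vw, of TT] disjoint_sum[OF finite_nodes A, of "fst ` M"]
    disjoint_sum[OF finite_nodes B, of "snd ` M"]
  show ?thesis
    by (simp add: prefix_cost_def mapping_cost_def)
qed

text \<open>The hypothesis \<open>closed\<close> says that the cell \<open>(i, j)\<close> lies on the alignment path of \<open>M\<close>: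
  no pair of \<open>M\<close> straddles the two prefixes.\<close>

lemma sed_struct_table_le_prefix_cost:
  assumes M: "edit_mapping T1 T2 M" and cost: "mapping_cost T1 T2 M \<le> \<tau>"
    and S1: "S1 = traversal TT T1" and S2: "S2 = traversal TT T2"
    and "i \<le> length S1" "j \<le> length S2"
    and closed: "\<And>v w. (v, w) \<in> M \<Longrightarrow> v \<in> set (take i S1) \<longleftrightarrow> w \<in> set (take j S2)"
  shows "sed_struct_table (axis_set TT) T1 T2 S1 S2 \<tau> i j \<le>
    enat (prefix_cost T1 T2 M (set (take i S1)) (set (take j S2)))"
  using assms(5-)
proof (induction "i + j" arbitrary: i j rule: less_induct)
  case less
  let ?D = "sed_struct_table (axis_set TT) T1 T2 S1 S2 \<tau>"
  let ?A = "\<lambda>i. set (take i S1)" and ?B = "\<lambda>j. set (take j S2)"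
  let ?C = "\<lambda>i j. prefix_cost T1 T2 M (?A i) (?B j)"
  have distinct: "distinct S1" "distinct S2"
    using S1 S2 distinct_traversal by auto
  have before1: "before TT u (S1 ! k)" if "k < length S1" "u \<in> ?A k" for k u
    using that sorted_traversal[of TT T1] S1 by (auto intro: sorted_wrt_take_nth)
  have before2: "before TT u (S2 ! k)" if "k < length S2" "u \<in> ?B k" for k u
    using that sorted_traversal[of TT T2] S2 by (auto intro: sorted_wrt_take_nth)
  show ?case
  proof (cases j)
    case 0
    \<comment> \<open>The other prefix is empty, so \<open>closed\<close> leaves every node of this
      one unmapped, at charge 1 each.\<close>
    then have "fst ` M \<inter> ?A i = {}"
      using less.prems(3) by fastforce
    then have "?A i - fst ` M = ?A i" by blast
    then have "i \<le> ?C i j"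
      using distinct_card[of "take i S1"] distinct less.prems(1) by (simp add: prefix_cost_def)
    then show ?thesis using 0 by simp
  next
    case j: (Suc l)
    show ?thesis
    proof (cases i)
      case 0
      then have "snd ` M \<inter> ?B j = {}"
        using less.prems(3) by fastforce
      then have "?B j - snd ` M = ?B j" by blast
      then have "j \<le> ?C i j"
        using distinct_card[of "take j S2"] distinct less.prems(2) by (simp add: prefix_cost_def)
      then show ?thesis using 0 j by simp
    next
      case i: (Suc k)
      let ?v = "S1 ! k" and ?w = "S2 ! l"
      have k: "k < length S1" and l: "l < length S2"
        using less.prems i j by auto
      have A: "?A i = insert ?v (?A k)" and B: "?B j = insert ?w (?B l)"
        using k l by (auto simp: i j take_Suc_conv_app_nth)
      have new: "?v \<notin> ?A k" "?w \<notin> ?B l"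
        using before1[OF k] before2[OF l] before_irrefl by blast+
      \<comment> \<open>The last nodes of the two prefixes determine the predecessor on the path: an
        unmapped one is dropped alone, two mapped ones are dropped together.\<close>
      consider "?v \<notin> fst ` M" | "?w \<notin> snd ` M" | "?v \<in> fst ` M" "?w \<in> snd ` M" by blast
      then show ?thesis
      proof cases
        case 1
        then have "v \<in> ?A k \<longleftrightarrow> w \<in> ?B j" if "(v, w) \<in> M" for v w
          using less.prems(3)[OF that] that unfolding A Domain_fst[symmetric] by blast
        then have "?D k j \<le> enat (?C k j)"
          using less.hyps[of k j] less.prems i by simp
        moreover have "?C i j = ?C k j + 1"
          unfolding A using 1 new by (intro prefix_cost_insert_left) auto
        moreover have "?D i j \<le> ?D k j + 1"
          unfolding i j sed_struct_table.simps(3) by (rule Min_le) blast+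
        ultimately show ?thesis
          using add_le_enat_add[of "?D k j" "?C k j" 1] unfolding one_enat_def by (metis order_trans)
      next
        case 2
        then have "v \<in> ?A i \<longleftrightarrow> w \<in> ?B l" if "(v, w) \<in> M" for v w
          using less.prems(3)[OF that] that unfolding B Range_snd[symmetric] by blast
        then have "?D i l \<le> enat (?C i l)"
          using less.hyps[of i l] less.prems j by simp
        moreover have "?C i j = ?C i l + 1"
          unfolding B using 2 new by (intro prefix_cost_insert_right) auto
        moreover have "?D i j \<le> ?D i l + 1"
          unfolding i j sed_struct_table.simps(3) by (rule Min_le) blast+
        ultimately show ?thesis
          using add_le_enat_add[of "?D i l" "?C i l" 1] unfolding one_enat_def by (metis order_trans)
      next
        case 3
        then obtain v w where v: "(v, ?w) \<in> M" and w: "(?v, w) \<in> M"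
          unfolding Domain_fst[symmetric] Range_snd[symmetric] by blast
        \<comment> \<open>The partners of the two last nodes lie in the prefixes. Were they not the
          last nodes themselves, both would come strictly earlier, and the pairs
          \<open>(v, ?w)\<close> and \<open>(?v, w)\<close> would cross, although \<open>M\<close>
          preserves \<open>before\<close>.\<close>
        have "v \<in> insert ?v (?A k)" "w \<in> insert ?w (?B l)"
          using less.prems(3)[OF v] less.prems(3)[OF w] A B by auto
        moreover have "\<not> (before TT v ?v \<and> before TT w ?w)"
          using edit_mapping_before[OF M v w] before_asym by blast
        moreover have "v = ?v \<longleftrightarrow> w = ?w"
          using edit_mappingD(1)[OF M v w] by blast
        ultimately have vw: "(?v, ?w) \<in> M"
          using before1[OF k] before2[OF l] v by blast
        have "v' \<in> ?A k \<longleftrightarrow> w' \<in> ?B l" if "(v', w') \<in> M" for v' w'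
        proof -
          have "v' = ?v \<longleftrightarrow> w' = ?w"
            using edit_mappingD(1)[OF M that vw] by blast
          then show ?thesis
            using less.prems(3)[OF that] new unfolding A B by blast
        qed
        then have IH: "?D k l \<le> enat (?C k l)"
          using less.hyps[of k l] less.prems i j by simp
        have "struct_diff (axis_set TT) T1 T2 ?v ?w + ?C k l \<le> \<tau>"
        proof (rule order_trans[OF struct_diff_prefix_cost_le cost])
          show "?A k \<subseteq> nodes T1" "?B l \<subseteq> nodes T2"
            unfolding set_traversal[of TT, symmetric] S1 S2 by (rule set_take_subset)+
        qed (use M vw before1[OF k] before2[OF l] in auto)
        then have "enat (struct_diff (axis_set TT) T1 T2 ?v ?w) + enat (?C k l) \<le> enat \<tau>"
          by simp
        \<comment> \<open>The cutoff tests the table entry rather than the prefix cost; the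
          induction hypothesis bounds the former by the latter.\<close>
        then have within: "enat (struct_diff (axis_set TT) T1 T2 ?v ?w) + ?D k l \<le> enat \<tau>"
          by (rule order_trans[OF add_left_mono[OF IH]])
        have "?D i j \<le> ?D k l +
          (if enat (struct_diff (axis_set TT) T1 T2 ?v ?w) + ?D k l > enat \<tau> then \<infinity>
           else if lbl T1 ?v = lbl T2 ?w then 0 else 1)"
          unfolding i j sed_struct_table.simps(3) by (rule Min_le) blast+
        also have "\<dots> = ?D k l + enat (of_bool (lbl T1 ?v \<noteq> lbl T2 ?w))"
          using leD[OF within] by (simp only: if_False) (simp add: zero_enat_def one_enat_def)
        also have "\<dots> \<le> enat (?C k l + of_bool (lbl T1 ?v \<noteq> lbl T2 ?w))"
          using IH by (rule add_le_enat_add)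
        also have "?C k l + of_bool (lbl T1 ?v \<noteq> lbl T2 ?w) = ?C i j"
          unfolding A B using prefix_cost_insert_both[OF M vw new(1)] by simp
        finally show ?thesis .
      qed
    qed
  qed
qed

theorem theorem5p2:
  fixes T1 T2 :: "'a tree" and TT :: traversal_order and S1 S2 :: "pos list" and \<tau> :: nat
  assumes "S1 = traversal TT T1" and "S2 = traversal TT T2"
  shows "(tree_edit_distance T1 T2 \<le> \<tau> \<longrightarrow>
            enat (sed T1 T2 S1 S2) \<le> sed_struct (axis_set TT) T1 T2 S1 S2 \<tau> \<and>
            sed_struct (axis_set TT) T1 T2 S1 S2 \<tau> \<le> enat (tree_edit_distance T1 T2) \<and>
            tree_edit_distance T1 T2 \<le> \<tau>) \<and>
         (sed_struct (axis_set TT) T1 T2 S1 S2 \<tau> > enat \<tau> \<longrightarrow> tree_edit_distance T1 T2 > \<tau>)"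
proof -
  have bound: "sed_struct (axis_set TT) T1 T2 S1 S2 \<tau> \<le> enat (tree_edit_distance T1 T2)"
    if le: "tree_edit_distance T1 T2 \<le> \<tau>"
  proof -
    have "tree_edit_distance T1 T2 \<in> mapping_cost T1 T2 ` {M. edit_mapping T1 T2 M}"
      unfolding tree_edit_distance_def using edit_mapping_empty[of T1 T2]
      by (intro Min_in) (auto simp: finite_edit_mappings)
    then obtain M where M: "edit_mapping T1 T2 M" "mapping_cost T1 T2 M = tree_edit_distance T1 T2"
      by auto
    have sub: "M \<subseteq> nodes T1 \<times> nodes T2"
      using M(1) by (simp add: edit_mapping_def)
    have set: "set S1 = nodes T1" "set S2 = nodes T2"
      using assms set_traversal by blast+
    have "{(v, w) \<in> M. v \<in> nodes T1} = M"
      using sub by auto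
    \<comment> \<open>At the final cell the prefixes are the whole node sets, so the prefix cost of
      the optimal \<open>M\<close> is its full cost.\<close>
    then have cost: "prefix_cost T1 T2 M (set S1) (set S2) = mapping_cost T1 T2 M"
      by (simp add: prefix_cost_def mapping_cost_def set)
    have "v \<in> set S1 \<longleftrightarrow> w \<in> set S2" if "(v, w) \<in> M" for v w
      using that sub by (auto simp: set)
    then have "sed_struct (axis_set TT) T1 T2 S1 S2 \<tau> \<le>
      enat (prefix_cost T1 T2 M (set S1) (set S2))"
      unfolding sed_struct_def
      using sed_struct_table_le_prefix_cost[OF M(1) _ assms, of \<tau> "length S1" "length S2"] M(2) le
      by simp
    then show ?thesis
      by (simp add: cost M(2))
  qed
  have "enat (sed T1 T2 S1 S2) \<le> sed_struct (axis_set TT) T1 T2 S1 S2 \<tau>"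
    by (simp add: sed_def sed_struct_def sed_table_le_sed_struct_table)
  \<comment> \<open>Contrapositive of \<open>bound\<close>: a distance of at most
    \<open>\<tau>\<close> would keep the score at most \<open>\<tau>\<close>.\<close>
  moreover have "tree_edit_distance T1 T2 > \<tau>"
    if "sed_struct (axis_set TT) T1 T2 S1 S2 \<tau> > enat \<tau>"
    using that bound by (meson enat_ord_simps(1) leD leI order_trans)
  ultimately show ?thesis
    using bound by blast
qed

end
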